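(* Consider the special case $\mathbf R=\lambda\mathbf I$ (with $\lambda>0$) and $\mathbf S=\mathbf 0$. Then the error covariance matrix $\mathbf C$ of the LMMSE estimator of $\mathbf h$ from $\mathbf z$ is $$\mathbf C=\lambda\left(1-\frac{p^{\mathrm{UE}}\lambda}{p^{\mathrm{UE}}\lambda(1+\kappa_t^{\mathrm{UE}}+\kappa_r^{\mathrm{BS}})+\sigma_{\mathrm{BS}}^2}\right)\mathbf I ,$$ and in the high uplink power regime $$\lim_{p^{\mathrm{UE}}\to\infty}\mathbf C=\lambda\left(1-\frac{1}{1+\kappa_t^{\mathrm{UE}}+\kappa_r^{\mathrm{BS}}}\right)\mathbf I .$$
   Context: The channel is $\mathbf h=[h_1\,\dots\,h_N]^T\sim\mathcal{CN}(\mathbf 0,\mathbf R)$ and the uplink pilot observation is $\mathbf z=\mathbf h(d+\eta_t^{\mathrm{UE}})+\boldsymbol\eta_r^{\mathrm{BS}}+\boldsymbol\nu$, where $d\in\mathbb C$ is a deterministic known pilot with $p^{\mathrm{UE}}=|d|^2$. For given $\mathbf h$, the distortion noises are independent with $\eta_t^{\mathrm{UE}}\sim\mathcal{CN}(0,\kappa_t^{\mathrm{UE}}p^{\mathrm{UE}})$ and $\boldsymbol\eta_r^{\mathrm{BS}}\sim\mathcal{CN}(\mathbf 0,\kappa_r^{\mathrm{BS}}p^{\mathrm{UE}}\,\mathrm{diag}(|h_1|^2,\dots,|h_N|^2))$, with constants $\kappa_t^{\mathrm{UE}},\kappa_r^{\mathrm{BS}}\ge0$. The term $\boldsymbol\nu$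 is the sum of receiver noise $\mathcal{CN}(\mathbf 0,\sigma_{\mathrm{BS}}^2\mathbf I)$, $\sigma_{\mathrm{BS}}^2>0$, independent of everything else, and zero-mean interference of covariance $\mathbf S$ (so for $\mathbf S=\mathbf 0$ only the noise is present). The LMMSE estimator is the $\hat{\mathbf h}=\mathbf A\mathbf z$ ($\mathbf A\in\mathbb C^{N\times N}$) minimizing $\mathbb E\{\|\hat{\mathbf h}-\mathbf h\|_2^2\}$, and $\mathbf C=\mathbb E\{(\hat{\mathbf h}-\mathbf h)(\hat{\mathbf h}-\mathbf h)^H\}$; explicitly, $\mathbf C=\mathbf R-p^{\mathrm{UE}}\mathbf R\bar{\mathbf Z}^{-1}\mathbf R$ with $\bar{\mathbf Z}=\mathbb E\{\mathbf z\mathbf z^H\}=p^{\mathrm{UE}}(1+\kappa_t^{\mathrm{UE}})\mathbf R+p^{\mathrm{UE}}\kappa_r^{\mathrm{BS}}\mathbf R_{\mathrm{diag}}+\mathbf S+\sigma_{\mathrm{BS}}^2\mathbf I$, where $\mathbf R_{\mathrm{diag}}$ is the diagonal part of $\mathbf R$. *)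

theory Defs
  imports "HOL-Probability.Probability"
begin

definition herm_transpose :: "complex^'n^'m \<Rightarrow> complex^'m^'n" where
  "herm_transpose A = (\<chi> i j. cnj (A $ j $ i))"

(* outer x y is the matrix x y^H *)
definition outer :: "complex^'m \<Rightarrow> complex^'n \<Rightarrow> complex^'n^'m" where
  "outer x y = (\<chi> i j. x $ i * cnj (y $ j))"

(* The circularly symmetric law CN(0,v) of a complex scalar, as the law of sqrt v * w with
   w ~ CN(0,1), so that v = 0 gives the point mass at 0. *)
definition std_complex_normal :: "complex measure" where
  "std_complex_normal = density lborel (\<lambda>x. ennreal (exp (- (cmod x)\<^sup>2) / pi))"

definition complex_normal :: "real \<Rightarrow> complex measure" where
  "complex_normal v = distr std_complex_normal borel (\<lambda>x. of_real (sqrt v) * x)"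

(* The law CN(0,Q) on complex vectors for any positive semidefinite, possibly singular, Q: the law
   of B w with w ~ CN(0,I) and B B^H = Q. The law depends on Q only, not on the choice of B, and
   no B exists unless Q is Hermitian and positive semidefinite. *)
definition std_complex_normal_vec :: "(complex^'n) measure" where
  "std_complex_normal_vec =
     density lborel (\<lambda>x. ennreal (exp (- (norm x)\<^sup>2) / pi ^ CARD('n)))"

definition is_complex_normal_vec :: "complex^'n^'n \<Rightarrow> (complex^'n) measure \<Rightarrow> bool" where
  "is_complex_normal_vec Q \<mu> \<longleftrightarrow>
     (\<exists>B :: complex^'n^'n. B ** herm_transpose B = Q \<and>
        \<mu> = distr std_complex_normal_vec borel (\<lambda>x. B *v x))"

(* K is a regular conditional law of Y given X. *)
definition is_conditional_law ::
  "'a measure \<Rightarrow> ('a \<Rightarrow> 'b::topological_space) \<Rightarrow> ('a \<Rightarrow> 'c::topological_space) \<Rightarrow>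
     ('b \<Rightarrow> 'c measure) \<Rightarrow> bool" where
  "is_conditional_law M X Y K \<longleftrightarrow>
     K \<in> borel \<rightarrow>\<^sub>M prob_algebra borel \<and>
     (\<forall>A\<in>sets borel. \<forall>B\<in>sets borel.
        emeasure M {\<omega> \<in> space M. X \<omega> \<in> A \<and> Y \<omega> \<in> B} =
        (\<integral>\<^sup>+x\<in>A. emeasure (K x) B \<partial>distr M borel X))"

definition zero_mean_with_cov ::
  "'a measure \<Rightarrow> ('a \<Rightarrow> complex^'n) \<Rightarrow> complex^'n^'n \<Rightarrow> bool" where
  "zero_mean_with_cov M X Q \<longleftrightarrow>
     X \<in> borel_measurable M \<and> integrable M (\<lambda>\<omega>. (norm (X \<omega>))\<^sup>2) \<and>
     (\<integral>\<omega>. X \<omega> \<partial>M) = 0 \<and> (\<integral>\<omega>. outer (X \<omega>) (X \<omega>) \<partial>M) = Q"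

definition pilot_power :: "complex \<Rightarrow> real" where
  "pilot_power d = (cmod d)\<^sup>2"

(* The covariance kr * p * diag(|x_1|^2, ..., |x_N|^2) of the receiver distortion given h = x. *)
definition rx_distortion_cov :: "real \<Rightarrow> real \<Rightarrow> complex^'n \<Rightarrow> complex^'n^'n" where
  "rx_distortion_cov kr p x =
     (\<chi> i j. if i = j then of_real (kr * p * (cmod (x $ i))\<^sup>2) else 0)"

(* et and er are the transmitter and receiver distortions, n the receiver noise and w the
   interference; R and S are the covariances of h and w, and sigma^2 is the noise variance.
   Given h, the distortions are independent, so their joint conditional law is a product.
   The correlation between w and (h, et, er) is left unrestricted; it vanishes when S = 0,
   since then w = 0 almost surely. *)
locale uplink_pilot_model = prob_space M
  for M :: "'a measure" +
  fixes R S :: "complex^'n^'n"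
    and kt kr \<sigma> :: real
    and d :: complex
    and h :: "'a \<Rightarrow> complex^'n"
    and et :: "'a \<Rightarrow> complex"
    and er n w :: "'a \<Rightarrow> complex^'n"
  assumes kt_nonneg: "kt \<ge> 0"
    and kr_nonneg: "kr \<ge> 0"
    and sigma_pos: "\<sigma> > 0"
    and measurable_rvs:
      "h \<in> borel_measurable M" "et \<in> borel_measurable M" "er \<in> borel_measurable M"
      "n \<in> borel_measurable M" "w \<in> borel_measurable M"
    and channel_law: "is_complex_normal_vec R (distr M borel h)"
    and distortion_law:
      "\<exists>Kr. (\<forall>x. is_complex_normal_vec (rx_distortion_cov kr (pilot_power d) x) (Kr x)) \<and>
            is_conditional_law M h (\<lambda>\<omega>. (et \<omega>, er \<omega>))
              (\<lambda>x. complex_normal (kt * pilot_power d) \<Otimes>\<^sub>M Kr x)"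
    and noise_law: "is_complex_normal_vec ((\<sigma>\<^sup>2) *\<^sub>R mat 1) (distr M borel n)"
    and noise_indep:
      "indep_set (sets (vimage_algebra (space M) n borel))
         (sets (vimage_algebra (space M) (\<lambda>\<omega>. (h \<omega>, et \<omega>, er \<omega>, w \<omega>)) borel))"
    and interference: "zero_mean_with_cov M w S"

definition pilot_observation ::
  "complex \<Rightarrow> ('a \<Rightarrow> complex^'n) \<Rightarrow> ('a \<Rightarrow> complex) \<Rightarrow> ('a \<Rightarrow> complex^'n) \<Rightarrow>
     ('a \<Rightarrow> complex^'n) \<Rightarrow> 'a \<Rightarrow> complex^'n" where
  "pilot_observation d h et er \<nu> = (\<lambda>\<omega>. (d + et \<omega>) *s h \<omega> + er \<omega> + \<nu> \<omega>)"

definition mse ::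
  "'a measure \<Rightarrow> ('a \<Rightarrow> complex^'n) \<Rightarrow> ('a \<Rightarrow> complex^'n) \<Rightarrow> complex^'n^'n \<Rightarrow> real" where
  "mse M h z A = (\<integral>\<omega>. (norm (A *v z \<omega> - h \<omega>))\<^sup>2 \<partial>M)"

definition is_lmmse_matrix ::
  "'a measure \<Rightarrow> ('a \<Rightarrow> complex^'n) \<Rightarrow> ('a \<Rightarrow> complex^'n) \<Rightarrow> complex^'n^'n \<Rightarrow> bool" where
  "is_lmmse_matrix M h z A \<longleftrightarrow> (\<forall>B. mse M h z A \<le> mse M h z B)"

definition lmmse_estimator ::
  "'a measure \<Rightarrow> ('a \<Rightarrow> complex^'n) \<Rightarrow> ('a \<Rightarrow> complex^'n) \<Rightarrow> 'a \<Rightarrow> complex^'n" where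
  "lmmse_estimator M h z = (\<lambda>\<omega>. (THE A. is_lmmse_matrix M h z A) *v z \<omega>)"

definition error_cov ::
  "'a measure \<Rightarrow> ('a \<Rightarrow> complex^'n) \<Rightarrow> ('a \<Rightarrow> complex^'n) \<Rightarrow> complex^'n^'n" where
  "error_cov M h hhat = (\<integral>\<omega>. outer (hhat \<omega> - h \<omega>) (hhat \<omega> - h \<omega>) \<partial>M)"

end

theory Submission
  imports Defs
begin

text \<open>
  Everything is read off the quadratic form E |u.z - v.h|^2, where u.x denotes the bilinear sum of
  the u_i x_i. Being nonnegative, its integrand can be integrated iteratively without any
  integrability check: first over the noise n, which is independent of the rest, then over the
  distortions given h, then over h. The inner steps only need the mean and the second moments of a
  complex normal law, which do not depend on the chosen factor B with B B^H = Q. The result is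
  lam |d u - v|^2 + (p lam (kt + kr) + sigma^2) |u|^2, and completing the square turns it into
  c |u - alpha v|^2 + k |v|^2 with c = p lam (1 + kt + kr) + sigma^2, alpha = lam cnj d / c and
  k = lam - p lam^2 / c. Summing over the rows of A (with v running over the standard basis) shows
  that alpha I is the unique minimizer of the mean square error; taking u = alpha v shows that the
  quadratic form of the error covariance is k |v|^2, so by polarization that matrix is k I.
\<close>

section \<open>Second moments of complex normal laws\<close>

text \<open>Every real coordinate has variance 1/2. Since \<open>DIM\<close> is 2 for
  \<open>complex\<close> and 2N for complex vectors, one definition covers both CN(0,1) and
  CN(0,I).\<close>

definition std_gaussian :: "'a::euclidean_space measure" where
  "std_gaussian = density lborel (\<lambda>x. ennreal (exp (- (norm x)\<^sup>2) / sqrt pi ^ DIM('a)))"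

lemma std_complex_normal_eq: "std_complex_normal = std_gaussian"
  by (simp add: std_complex_normal_def std_gaussian_def)

lemma std_complex_normal_vec_eq:
  "(std_complex_normal_vec :: (complex^'n) measure) = std_gaussian"
  by (simp add: std_complex_normal_vec_def std_gaussian_def power_mult mult.commute[of "CARD('n)"])

lemma sets_std_gaussian [simp, measurable_cong]: "sets std_gaussian = sets borel"
  by (simp add: std_gaussian_def)

lemma space_std_gaussian [simp]: "space std_gaussian = UNIV"
  by (simp add: std_gaussian_def)

lemma std_gaussian_density_prod:
  fixes x :: "'a::euclidean_space"
  shows "exp (- (norm x)\<^sup>2) / sqrt pi ^ DIM('a) = (\<Prod>b\<in>Basis. exp (- (x \<bullet> b)\<^sup>2) / sqrt pi)"
  unfolding prod_dividef power2_norm_eq_inner euclidean_inner[of x x]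
  by (simp add: exp_sum[symmetric] sum_negf power2_eq_square)

lemma nn_integral_gaussian_1D:
  "(\<integral>\<^sup>+t. ennreal (exp (- t\<^sup>2) / sqrt pi) \<partial>lborel) = 1"
  "(\<integral>\<^sup>+t. ennreal (t\<^sup>2 * (exp (- t\<^sup>2) / sqrt pi)) \<partial>lborel) = ennreal (1 / 2)"
proof -
  \<comment> \<open>The standard deviation \<open>1 / sqrt 2\<close> matches a variance of 1/2; the
    even moments of orders 0 and 2 are then the two claims.\<close>
  have density: "normal_density 0 (1 / sqrt 2) t = exp (- t\<^sup>2) / sqrt pi" for t
    by (simp add: normal_density_def power_divide)
  have moment: "(\<integral>\<^sup>+t. ennreal (exp (- t\<^sup>2) / sqrt pi * t ^ (2 * k)) \<partial>lborel) =
      ennreal (fact (2 * k) / (4 ^ k * fact k))" for k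
    using normal_moment_even[of "1 / sqrt 2" 0 k]
    by (subst nn_integral_eq_integrable) (simp_all add: density has_bochner_integral_iff power_divide)
  show "(\<integral>\<^sup>+t. ennreal (exp (- t\<^sup>2) / sqrt pi) \<partial>lborel) = 1"
    using moment[of 0] by simp
  show "(\<integral>\<^sup>+t. ennreal (t\<^sup>2 * (exp (- t\<^sup>2) / sqrt pi)) \<partial>lborel) = ennreal (1 / 2)"
    using moment[of 1] by (simp add: mult.commute)
qed

text \<open>The Gaussian density and Lebesgue measure both factor over the coordinates, and
  nonnegativity lets \<open>ennreal\<close> commute with the products.\<close>

lemma nn_integral_std_gaussian_prod:
  assumes [measurable]: "\<And>b. b \<in> Basis \<Longrightarrow> f b \<in> borel_measurable borel"
    and nonneg: "\<And>b t. f b t \<ge> 0"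
  shows "(\<integral>\<^sup>+x. ennreal (\<Prod>b\<in>Basis. f b (x \<bullet> b)) \<partial>(std_gaussian :: 'a::euclidean_space measure)) =
    (\<Prod>b\<in>(Basis :: 'a set). \<integral>\<^sup>+t. ennreal (f b t * (exp (- t\<^sup>2) / sqrt pi)) \<partial>lborel)"
proof -
  have "(\<integral>\<^sup>+x. ennreal (\<Prod>b\<in>Basis. f b (x \<bullet> b)) \<partial>(std_gaussian :: 'a measure)) =
    (\<integral>\<^sup>+x. (\<Prod>b\<in>Basis. ennreal (f b (x \<bullet> b) * (exp (- (x \<bullet> b)\<^sup>2) / sqrt pi))) \<partial>(lborel :: 'a measure))"
    unfolding std_gaussian_def std_gaussian_density_prod
    by (subst nn_integral_density)
       (auto intro!: nn_integral_cong
         simp: nonneg prod_nonneg prod_ennreal ennreal_mult[symmetric] prod.distrib[symmetric] mult.commute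
         simp del: times_divide_eq_right times_divide_eq_left)
  also have "\<dots> = (\<Prod>b\<in>(Basis :: 'a set). \<integral>\<^sup>+t. ennreal (f b t * (exp (- t\<^sup>2) / sqrt pi)) \<partial>lborel)"
    by (intro nn_integral_lborel_prod) auto
  finally show ?thesis .
qed

lemma prob_space_std_gaussian: "prob_space (std_gaussian :: 'a::euclidean_space measure)"
proof (rule prob_spaceI)
  show "emeasure (std_gaussian :: 'a measure) (space std_gaussian) = 1"
    using nn_integral_std_gaussian_prod[of "\<lambda>(_::'a) _. 1"]
    by (simp add: nn_integral_gaussian_1D)
qed

lemma std_gaussian_coordinate_square:
  fixes b :: "'a::euclidean_space"
  assumes b: "b \<in> Basis"
  shows "integrable std_gaussian (\<lambda>x::'a. (x \<bullet> b)\<^sup>2)" "(\<integral>x. (x \<bullet> b)\<^sup>2 \<partial>(std_gaussian :: 'a measure)) = 1 / 2"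
proof -
  \<comment> \<open>A single factor carries the square; all others are constant and contribute total
    mass one.\<close>
  let ?f = "\<lambda>c t::real. if c = b then t\<^sup>2 else 1"
  have "(\<integral>\<^sup>+x. ennreal ((x \<bullet> b)\<^sup>2) \<partial>(std_gaussian :: 'a measure)) =
      (\<integral>\<^sup>+x. ennreal (\<Prod>c\<in>Basis. ?f c (x \<bullet> c)) \<partial>std_gaussian)"
  proof (intro nn_integral_cong arg_cong[of _ _ ennreal])
    fix x :: 'a
    have "(\<Prod>c\<in>Basis. ?f c (x \<bullet> c)) = (\<Prod>c\<in>Basis. if c = b then (x \<bullet> b)\<^sup>2 else 1)"
      by (intro prod.cong) auto
    then show "(x \<bullet> b)\<^sup>2 = (\<Prod>c\<in>Basis. ?f c (x \<bullet> c))"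
      using b by simp
  qed
  also have "\<dots> = (\<Prod>c\<in>Basis. \<integral>\<^sup>+t. ennreal (?f c t * (exp (- t\<^sup>2) / sqrt pi)) \<partial>lborel)"
    by (rule nn_integral_std_gaussian_prod) auto
  also have "\<dots> = (\<Prod>c\<in>Basis. if c = b then ennreal (1 / 2) else 1)"
    by (intro prod.cong) (simp_all add: nn_integral_gaussian_1D del: times_divide_eq_right)
  also have "\<dots> = ennreal (1 / 2)"
    using b by simp
  finally show "integrable std_gaussian (\<lambda>x::'a. (x \<bullet> b)\<^sup>2)"
    "(\<integral>x. (x \<bullet> b)\<^sup>2 \<partial>(std_gaussian :: 'a measure)) = 1 / 2"
    by (subst (asm) nn_integral_eq_integrable; simp)+
qed

text \<open>For a basis vector \<open>b\<close> this is the reflection in the hyperplane orthogonal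
  to \<open>b\<close>. Symmetry under it makes the first moments and the mixed second moments vanish
  without computing an integral.\<close>

definition flip_coordinate :: "'a::euclidean_space \<Rightarrow> 'a \<Rightarrow> 'a" where
  "flip_coordinate b x = x - (2 * (x \<bullet> b)) *\<^sub>R b"

lemma inner_flip_coordinate:
  assumes "b \<in> Basis" "c \<in> Basis"
  shows "flip_coordinate b x \<bullet> c = (if c = b then - (x \<bullet> c) else x \<bullet> c)"
  using assms by (auto simp: flip_coordinate_def inner_diff_left inner_Basis)

text \<open>The reflection preserves Lebesgue measure, because its diagonal entries
  \<open>c j\<close> are 1 and -1, and it preserves the norm, hence the density.\<close>

lemma integral_std_gaussian_flip:
  fixes b :: "'a::euclidean_space" and f :: "'a \<Rightarrow> real"
  assumes b: "b \<in> Basis" and [measurable]: "f \<in> borel_measurable borel"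
  shows "(\<integral>x. f (flip_coordinate b x) \<partial>std_gaussian) = (\<integral>x. f x \<partial>std_gaussian)"
proof -
  define c :: "'a \<Rightarrow> real" where "c j = (if j = b then - 1 else 1)" for j
  have flip: "0 + (\<Sum>j\<in>Basis. (c j * (x \<bullet> j)) *\<^sub>R j) = flip_coordinate b x" for x
    by (rule euclidean_eqI) (auto simp: inner_flip_coordinate b c_def)
  have [measurable]: "flip_coordinate b \<in> borel \<rightarrow>\<^sub>M borel"
    unfolding flip_coordinate_def[abs_def] by measurable
  have abs_prod: "(\<Prod>j\<in>(Basis :: 'a set). \<bar>c j\<bar>) = 1"
    by (intro prod.neutral) (simp add: c_def)
  have "(lborel :: 'a measure) =
      density (distr lborel borel (flip_coordinate b)) (\<lambda>_. ennreal (\<Prod>j\<in>Basis. \<bar>c j\<bar>))"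
    by (rule lborel_affine_euclidean[of c 0, unfolded flip]) (simp add: c_def)
  also have "\<dots> = distr lborel borel (flip_coordinate b)"
    by (simp add: abs_prod density_1)
  finally have lborel_flip: "distr lborel borel (flip_coordinate b) = (lborel :: 'a measure)" ..
  have norm_flip: "norm (flip_coordinate b x) = norm x" for x
  proof -
    have "flip_coordinate b x \<bullet> flip_coordinate b x = x \<bullet> x"
      unfolding euclidean_inner[of "flip_coordinate b x" "flip_coordinate b x"] euclidean_inner[of x x]
      by (intro sum.cong) (auto simp: inner_flip_coordinate b)
    then show ?thesis
      by (simp add: norm_eq_sqrt_inner)
  qed
  let ?g = "\<lambda>x::'a. exp (- (norm x)\<^sup>2) / sqrt pi ^ DIM('a)"
  have "(\<integral>x. f x \<partial>std_gaussian) = (\<integral>x. ?g x *\<^sub>R f x \<partial>lborel)"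
    unfolding std_gaussian_def by (subst integral_density) auto
  also have "\<dots> = (\<integral>x. ?g x *\<^sub>R f x \<partial>distr lborel borel (flip_coordinate b))"
    by (simp add: lborel_flip)
  also have "\<dots> = (\<integral>x. ?g x *\<^sub>R f (flip_coordinate b x) \<partial>lborel)"
    by (subst integral_distr) (auto simp: norm_flip)
  also have "\<dots> = (\<integral>x. f (flip_coordinate b x) \<partial>std_gaussian)"
    unfolding std_gaussian_def by (subst integral_density) auto
  finally show ?thesis ..
qed

text \<open>A finite second moment gives integrability on a probability space; reflection then shows
  that the integral equals its own negative.\<close>

lemma std_gaussian_coordinate:
  fixes b :: "'a::euclidean_space"
  assumes b: "b \<in> Basis"
  shows "integrable std_gaussian (\<lambda>x::'a. x \<bullet> b)" "(\<integral>x. x \<bullet> b \<partial>(std_gaussian :: 'a measure)) = 0"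
proof -
  interpret prob_space "std_gaussian :: 'a measure"
    by (rule prob_space_std_gaussian)
  show "integrable std_gaussian (\<lambda>x::'a. x \<bullet> b)"
    by (rule square_integrable_imp_integrable[OF _ std_gaussian_coordinate_square(1)[OF b]]) measurable
  have "(\<integral>x. - (x \<bullet> b) \<partial>(std_gaussian :: 'a measure)) = (\<integral>x. x \<bullet> b \<partial>std_gaussian)"
    using integral_std_gaussian_flip[OF b, of "\<lambda>x. x \<bullet> b"]
    unfolding inner_flip_coordinate[OF b b] by simp
  then show "(\<integral>x. x \<bullet> b \<partial>(std_gaussian :: 'a measure)) = 0"
    unfolding Bochner_Integration.integral_minus by linarith
qed

text \<open>For distinct coordinates, reflecting only one of them changes the sign of the product.
  The inequality between arithmetic and geometric mean supplies the integrable bound.\<close>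

lemma std_gaussian_coordinate_product:
  fixes b c :: "'a::euclidean_space"
  assumes bc: "b \<in> Basis" "c \<in> Basis"
  shows "integrable std_gaussian (\<lambda>x::'a. (x \<bullet> b) * (x \<bullet> c))"
    "(\<integral>x. (x \<bullet> b) * (x \<bullet> c) \<partial>(std_gaussian :: 'a measure)) = (if b = c then 1 / 2 else 0)"
proof -
  have bound: "norm (s * t) \<le> norm (s\<^sup>2 + t\<^sup>2)" for s t :: real
  proof -
    have "2 * \<bar>s * t\<bar> \<le> s\<^sup>2 + t\<^sup>2"
      using sum_squares_bound[of "\<bar>s\<bar>" "\<bar>t\<bar>"] by (simp add: abs_mult)
    then show ?thesis
      by simp
  qed
  show "integrable std_gaussian (\<lambda>x::'a. (x \<bullet> b) * (x \<bullet> c))"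
    by (rule Bochner_Integration.integrable_bound[OF Bochner_Integration.integrable_add[OF std_gaussian_coordinate_square(1)[OF bc(1)]
        std_gaussian_coordinate_square(1)[OF bc(2)]]]) (auto intro!: always_eventually bound simp del: real_norm_def)
  show "(\<integral>x. (x \<bullet> b) * (x \<bullet> c) \<partial>(std_gaussian :: 'a measure)) = (if b = c then 1 / 2 else 0)"
    using integral_std_gaussian_flip[OF bc(1), of "\<lambda>x. (x \<bullet> b) * (x \<bullet> c)"] bc
      std_gaussian_coordinate_square(2)[OF bc(1)]
    by (auto simp: inner_flip_coordinate power2_eq_square)
qed

text \<open>After expansion in coordinates only the constant and the diagonal products survive, the
  latter with weight 1/2 each.\<close>

lemma std_gaussian_affine_square:
  fixes y :: "'a::euclidean_space"
  shows "integrable std_gaussian (\<lambda>x. (\<alpha> + x \<bullet> y)\<^sup>2)"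
    "(\<integral>x. (\<alpha> + x \<bullet> y)\<^sup>2 \<partial>std_gaussian) = \<alpha>\<^sup>2 + (norm y)\<^sup>2 / 2"
proof -
  interpret prob_space "std_gaussian :: 'a measure"
    by (rule prob_space_std_gaussian)
  have expand: "(\<alpha> + x \<bullet> y)\<^sup>2 = \<alpha>\<^sup>2 + (\<Sum>b\<in>Basis. 2 * \<alpha> * (y \<bullet> b) * (x \<bullet> b)) +
      (\<Sum>b\<in>Basis. \<Sum>c\<in>Basis. (y \<bullet> b) * (y \<bullet> c) * ((x \<bullet> b) * (x \<bullet> c)))" for x
    unfolding euclidean_inner[of x y] power2_eq_square[of "\<alpha> + _"]
    by (simp add: algebra_simps sum_distrib_left sum_distrib_right sum_product power2_eq_square sum.distrib mult_2)
  note I = std_gaussian_coordinate[where 'a='a] std_gaussian_coordinate_product[where 'a='a]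
  have const: "has_bochner_integral (std_gaussian :: 'a measure) (\<lambda>_. \<alpha>\<^sup>2) (\<alpha>\<^sup>2)"
    using prob_space by (simp add: has_bochner_integral_iff)
  have "has_bochner_integral std_gaussian (\<lambda>x. (\<alpha> + x \<bullet> y)\<^sup>2)
      (\<alpha>\<^sup>2 + (\<Sum>b\<in>Basis. 2 * \<alpha> * (y \<bullet> b) * 0) +
       (\<Sum>b\<in>Basis. \<Sum>c\<in>Basis. (y \<bullet> b) * (y \<bullet> c) * (if b = c then 1 / 2 else 0)))"
    unfolding expand
    by (intro has_bochner_integral_add has_bochner_integral_sum has_bochner_integral_mult_right const)
       (simp_all add: has_bochner_integral_iff I)
  moreover have "(\<Sum>b\<in>Basis. \<Sum>c\<in>Basis. (y \<bullet> b) * (y \<bullet> c) * (if b = c then 1 / 2 else 0)) = (norm y)\<^sup>2 / 2"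
    unfolding power2_norm_eq_inner euclidean_inner[of y y]
    by (simp add: sum_divide_distrib if_distrib[of "(*) _"] cong: if_cong)
  ultimately show "integrable std_gaussian (\<lambda>x. (\<alpha> + x \<bullet> y)\<^sup>2)"
    "(\<integral>x. (\<alpha> + x \<bullet> y)\<^sup>2 \<partial>std_gaussian) = \<alpha>\<^sup>2 + (norm y)\<^sup>2 / 2"
    by (simp_all add: has_bochner_integral_iff)
qed

text \<open>The two squares are meant as those of the real and imaginary parts of an affine complex
  form; this is how complex moments reduce to real ones.\<close>

lemma nn_integral_std_gaussian_affine_squares:
  fixes y y' :: "'a::euclidean_space"
  shows "(\<integral>\<^sup>+x. ennreal ((\<alpha> + x \<bullet> y)\<^sup>2 + (\<beta> + x \<bullet> y')\<^sup>2) \<partial>std_gaussian) =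
    ennreal (\<alpha>\<^sup>2 + \<beta>\<^sup>2 + ((norm y)\<^sup>2 + (norm y')\<^sup>2) / 2)"
proof -
  have "integrable std_gaussian (\<lambda>x. (\<alpha> + x \<bullet> y)\<^sup>2 + (\<beta> + x \<bullet> y')\<^sup>2)"
    by (intro Bochner_Integration.integrable_add std_gaussian_affine_square)
  moreover have "(\<integral>x. (\<alpha> + x \<bullet> y)\<^sup>2 + (\<beta> + x \<bullet> y')\<^sup>2 \<partial>std_gaussian) =
      \<alpha>\<^sup>2 + \<beta>\<^sup>2 + ((norm y)\<^sup>2 + (norm y')\<^sup>2) / 2"
    by (subst Bochner_Integration.integral_add)
       (simp_all add: std_gaussian_affine_square add_divide_distrib)
  ultimately show ?thesis
    by (subst nn_integral_eq_integral) simp_all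
qed

section \<open>Complex linear forms under complex normal laws\<close>

text \<open>There is no conjugate, so that entry i of \<open>A *v x\<close> is
  \<open>cdot (A $ i) x\<close> and the rows of an estimator can be inserted directly.\<close>

definition cdot :: "complex^'n \<Rightarrow> complex^'n \<Rightarrow> complex" where
  "cdot u x = (\<Sum>i\<in>UNIV. u $ i * x $ i)"

lemma cdot_simps:
  "cdot u (x + y) = cdot u x + cdot u y"
  "cdot u (x - y) = cdot u x - cdot u y"
  "cdot u (c *s x) = c * cdot u x"
  "cdot (u + v) x = cdot u x + cdot v x"
  "cdot (c *s u) x = c * cdot u x"
  "cdot (u - v) x = cdot u x - cdot v x"
  "cdot u 0 = 0"
  by (simp_all add: cdot_def algebra_simps sum.distrib sum_subtractf sum_distrib_left sum_negf)

lemma cdot_axis: "cdot (axis i c) x = c * x $ i"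
  by (simp add: cdot_def axis_def if_distrib[of "\<lambda>c. c * _"] cong: if_cong)

text \<open>The real inner product of complex vectors is the real part of a sum of products x_i
  cnj(y_i), which accounts for the conjugated coefficients.\<close>

lemma cdot_eq_inner:
  "Re (cdot u x) = x \<bullet> (\<chi> i. cnj (u $ i))" "Im (cdot u x) = x \<bullet> (\<chi> i. \<i> * cnj (u $ i))"
  by (simp_all add: cdot_def inner_vec_def inner_complex_def Re_sum Im_sum algebra_simps)

lemma borel_measurable_cdot [measurable]: "cdot u \<in> borel_measurable borel"
proof (rule borel_measurable_continuous_onI)
  show "continuous_on UNIV (cdot u)"
    unfolding cdot_def[abs_def] by (intro continuous_intros)
qed

lemma norm_vec_power2: "(norm (x :: complex^'n))\<^sup>2 = (\<Sum>i\<in>UNIV. (cmod (x $ i))\<^sup>2)"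
  by (simp add: norm_vec_def L2_set_def sum_nonneg)

lemma norm_axis_power2: "(norm (axis i c :: complex^'n))\<^sup>2 = (cmod c)\<^sup>2"
  by (simp add: power2_norm_eq_inner inner_axis_axis)

text \<open>Both real coefficient vectors have norm \<open>norm u\<close>, so the two halves in the
  real formula add up to one full square.\<close>

lemma nn_integral_std_complex_normal_vec:
  "(\<integral>\<^sup>+x. ennreal ((cmod (a + cdot u x))\<^sup>2) \<partial>std_complex_normal_vec) =
    ennreal ((cmod a)\<^sup>2 + (norm u)\<^sup>2)"
  using nn_integral_std_gaussian_affine_squares
    [of "Re a" "\<chi> i. cnj (u $ i)" "Im a" "\<chi> i. \<i> * cnj (u $ i)"]
  unfolding std_complex_normal_vec_eq cmod_power2[of "_ + _"] plus_complex.sel cdot_eq_inner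
  by (simp add: cmod_power2[of a] norm_vec_power2 norm_mult)

lemma nn_integral_complex_normal:
  assumes "v \<ge> 0"
  shows "(\<integral>\<^sup>+x. ennreal ((cmod (a + x * b))\<^sup>2) \<partial>complex_normal v) =
    ennreal ((cmod a)\<^sup>2 + v * (cmod b)\<^sup>2)"
proof -
  let ?y = "of_real (sqrt v) * cnj b"
  have "(cmod (a + of_real (sqrt v) * x * b))\<^sup>2 =
      (Re a + x \<bullet> ?y)\<^sup>2 + (Im a + x \<bullet> (\<i> * ?y))\<^sup>2" for x
    by (simp add: cmod_power2 inner_complex_def algebra_simps)
  then have "(\<integral>\<^sup>+x. ennreal ((cmod (a + x * b))\<^sup>2) \<partial>complex_normal v) =
      (\<integral>\<^sup>+x. ennreal ((Re a + x \<bullet> ?y)\<^sup>2 + (Im a + x \<bullet> (\<i> * ?y))\<^sup>2) \<partial>std_gaussian)"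
    unfolding complex_normal_def std_complex_normal_eq by (subst nn_integral_distr) auto
  also have "\<dots> = ennreal ((cmod a)\<^sup>2 + v * (cmod b)\<^sup>2)"
    using assms unfolding nn_integral_std_gaussian_affine_squares
    by (simp add: norm_mult power_mult_distrib cmod_power2[of a])
  finally show ?thesis .
qed

lemma is_complex_normal_vecD:
  fixes Q :: "complex^'n^'n"
  assumes "is_complex_normal_vec Q \<mu>"
  shows "prob_space \<mu>" "sets \<mu> = sets borel"
proof -
  obtain B :: "complex^'n^'n" where \<mu>: "\<mu> = distr std_complex_normal_vec borel (\<lambda>x. B *v x)"
    using assms by (auto simp: is_complex_normal_vec_def)
  have [measurable]: "(\<lambda>x. B *v x) \<in> borel_measurable borel"
    by (intro borel_measurable_continuous_onI matrix_vector_mult_linear_continuous_on)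
  interpret prob_space "std_gaussian :: (complex^'n) measure"
    by (rule prob_space_std_gaussian)
  show "prob_space \<mu>"
    unfolding \<mu> std_complex_normal_vec_eq by (rule prob_space_distr) simp
  show "sets \<mu> = sets borel"
    by (simp add: \<mu>)
qed

lemma prob_space_complex_normal: "prob_space (complex_normal v)"
  unfolding complex_normal_def std_complex_normal_eq
  by (intro prob_space.prob_space_distr prob_space_std_gaussian) simp

lemma sets_complex_normal [simp, measurable_cong]: "sets (complex_normal v) = sets borel"
  by (simp add: complex_normal_def)

text \<open>The squared norm is u^T (B B^H) cnj(u), where only the diagonal of B B^H survives. Hence
  the choice of the factor \<open>B\<close> does not affect second moments.\<close>

lemma norm_vector_matrix_mult_power2:
  fixes B :: "complex^'n^'m"
  assumes "B ** herm_transpose B = (\<chi> i j. if i = j then of_real (q i) else 0)"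
  shows "(norm (u v* B))\<^sup>2 = (\<Sum>i\<in>UNIV. q i * (cmod (u $ i))\<^sup>2)"
proof -
  have gram: "(\<Sum>k\<in>UNIV. B $ i $ k * cnj (B $ j $ k)) = (if i = j then of_real (q i) else 0)" for i j
    using arg_cong[OF assms, of "\<lambda>Q. Q $ i $ j"]
    by (simp add: matrix_matrix_mult_def herm_transpose_def)
  have "complex_of_real ((norm (u v* B))\<^sup>2) =
      (\<Sum>k\<in>UNIV. (\<Sum>i\<in>UNIV. u $ i * B $ i $ k) * cnj (\<Sum>j\<in>UNIV. u $ j * B $ j $ k))"
    by (simp add: norm_vec_power2 vector_matrix_mult_def del: cnj_sum flip: complex_norm_square)
  also have "\<dots> = (\<Sum>k\<in>UNIV. \<Sum>i\<in>UNIV. \<Sum>j\<in>UNIV. u $ i * cnj (u $ j) * (B $ i $ k * cnj (B $ j $ k)))"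
    by (simp add: sum_product algebra_simps)
  also have "\<dots> = (\<Sum>i\<in>UNIV. \<Sum>k\<in>UNIV. \<Sum>j\<in>UNIV. u $ i * cnj (u $ j) * (B $ i $ k * cnj (B $ j $ k)))"
    by (rule sum.swap)
  also have "\<dots> = (\<Sum>i\<in>UNIV. \<Sum>j\<in>UNIV. \<Sum>k\<in>UNIV. u $ i * cnj (u $ j) * (B $ i $ k * cnj (B $ j $ k)))"
    by (intro sum.cong refl sum.swap)
  also have "\<dots> = (\<Sum>i\<in>UNIV. \<Sum>j\<in>UNIV. if i = j then u $ i * cnj (u $ i) * of_real (q i) else 0)"
    unfolding sum_distrib_left[symmetric] gram by (intro sum.cong) auto
  also have "\<dots> = complex_of_real (\<Sum>i\<in>UNIV. q i * (cmod (u $ i))\<^sup>2)"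
    by (simp add: mult.commute flip: complex_norm_square)
  finally show ?thesis
    by (simp only: of_real_eq_iff)
qed

text \<open>The factor moves to the coefficient vector: u.(B x) = (u^T B).x. Diagonal covariances
  suffice below: channel and noise have scalar ones, and the receiver distortion given h has a
  diagonal one.\<close>

lemma nn_integral_complex_normal_vec_diagonal:
  fixes Q :: "complex^'n^'n"
  assumes "is_complex_normal_vec Q \<mu>" "Q = (\<chi> i j. if i = j then of_real (q i) else 0)"
  shows "(\<integral>\<^sup>+x. ennreal ((cmod (a + cdot u x))\<^sup>2) \<partial>\<mu>) =
    ennreal ((cmod a)\<^sup>2 + (\<Sum>i\<in>UNIV. q i * (cmod (u $ i))\<^sup>2))"
proof -
  obtain B :: "complex^'n^'n" where B: "B ** herm_transpose B = Q"
    and \<mu>: "\<mu> = distr std_complex_normal_vec borel (\<lambda>x. B *v x)"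
    using assms(1) by (auto simp: is_complex_normal_vec_def)
  have [measurable]: "(\<lambda>x. B *v x) \<in> borel_measurable borel"
    by (intro borel_measurable_continuous_onI matrix_vector_mult_linear_continuous_on)
  have "cdot u (B *v x) = (\<Sum>i\<in>UNIV. \<Sum>j\<in>UNIV. B $ i $ j * u $ i * x $ j)" for x
    by (simp add: cdot_def matrix_vector_mult_def sum_distrib_left algebra_simps)
  also have "\<dots> x = cdot (u v* B) x" for x
    unfolding cdot_def vector_matrix_mult_def by (subst sum.swap) (simp add: sum_distrib_left sum_distrib_right mult_ac)
  finally have "(\<integral>\<^sup>+x. ennreal ((cmod (a + cdot u x))\<^sup>2) \<partial>\<mu>) =
      (\<integral>\<^sup>+x. ennreal ((cmod (a + cdot (u v* B) x))\<^sup>2) \<partial>std_complex_normal_vec)"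
    unfolding \<mu> std_complex_normal_vec_eq by (subst nn_integral_distr) auto
  then show ?thesis
    using B assms(2) by (simp add: nn_integral_std_complex_normal_vec norm_vector_matrix_mult_power2)
qed

lemma nn_integral_complex_normal_vec_scalar:
  fixes \<mu> :: "(complex^'n) measure"
  assumes "is_complex_normal_vec (c *\<^sub>R mat 1) \<mu>"
  shows "(\<integral>\<^sup>+x. ennreal ((cmod (a + cdot u x))\<^sup>2) \<partial>\<mu>) = ennreal ((cmod a)\<^sup>2 + c * (norm u)\<^sup>2)"
proof -
  have "(c *\<^sub>R mat 1 :: complex^'n^'n) = (\<chi> i j. if i = j then of_real c else 0)"
    by (simp add: vec_eq_iff mat_def of_real_def)
  from nn_integral_complex_normal_vec_diagonal[OF assms this] show ?thesis
    by (simp add: norm_vec_power2 sum_distrib_left)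
qed

section \<open>Second moments of the observation\<close>

text \<open>A conditional law is prescribed on rectangles only. These form an intersection-stable
  generator, so the joint law is the bind of the law of \<open>X\<close> with the kernel
  \<open>L\<close>, and iterated integration follows.\<close>

lemma nn_integral_conditional_law:
  fixes X :: "'a \<Rightarrow> 'b::topological_space" and Y :: "'a \<Rightarrow> 'c::topological_space"
  assumes M: "prob_space M" and X [measurable]: "X \<in> borel_measurable M"
    and Y [measurable]: "Y \<in> borel_measurable M" and cond: "is_conditional_law M X Y K"
    and f [measurable]: "f \<in> borel_measurable (borel \<Otimes>\<^sub>M borel)"
  shows "(\<integral>\<^sup>+\<omega>. f (X \<omega>, Y \<omega>) \<partial>M) = (\<integral>\<^sup>+x. \<integral>\<^sup>+y. f (x, y) \<partial>K x \<partial>distr M borel X)"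
proof -
  interpret prob_space M by fact
  have K [measurable]: "K \<in> borel \<rightarrow>\<^sub>M prob_algebra borel"
    and rect: "\<And>A B. A \<in> sets borel \<Longrightarrow> B \<in> sets borel \<Longrightarrow>
      emeasure M {\<omega> \<in> space M. X \<omega> \<in> A \<and> Y \<omega> \<in> B} = (\<integral>\<^sup>+x\<in>A. emeasure (K x) B \<partial>distr M borel X)"
    using cond by (auto simp: is_conditional_law_def)
  have sets_K [simp]: "sets (K x) = sets borel" for x
    using measurable_space[OF K, of x] by (simp add: space_prob_algebra)
  \<comment> \<open>The kernel \<open>K x\<close> is placed on the fibre over \<open>x\<close>: this
    is the law of the pair given X = x.\<close>
  define L where "L x = distr (K x) (borel \<Otimes>\<^sub>M borel) (Pair x)" for x
  have L [measurable]: "L \<in> borel \<rightarrow>\<^sub>M subprob_algebra (borel \<Otimes>\<^sub>M borel)"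
    unfolding L_def[abs_def] by (rule measurable_distr2[where M=borel]) (auto intro: measurable_prob_algebraD[OF K])
  have L': "L \<in> distr M borel X \<rightarrow>\<^sub>M subprob_algebra (borel \<Otimes>\<^sub>M borel)"
    by simp
  have "distr M (borel \<Otimes>\<^sub>M borel) (\<lambda>\<omega>. (X \<omega>, Y \<omega>)) = distr M borel X \<bind> L"
  proof (rule measure_eqI_generator_eq[OF Int_stable_pair_measure_generator[of borel borel],
        where \<Omega>=UNIV and A="\<lambda>_. UNIV"])
    fix R :: "('b \<times> 'c) set"
    assume "R \<in> {a \<times> b |a b. a \<in> sets borel \<and> b \<in> sets borel}"
    then obtain A B where R: "R = A \<times> B" and [measurable]: "A \<in> sets borel" "B \<in> sets borel"
      by auto
    have "emeasure (distr M (borel \<Otimes>\<^sub>M borel) (\<lambda>\<omega>. (X \<omega>, Y \<omega>))) R =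
        emeasure M {\<omega> \<in> space M. X \<omega> \<in> A \<and> Y \<omega> \<in> B}"
      unfolding R by (subst emeasure_distr) (auto intro!: arg_cong[of _ _ "emeasure M"])
    also have "\<dots> = (\<integral>\<^sup>+x. emeasure (L x) R \<partial>distr M borel X)"
      unfolding rect[OF \<open>A \<in> sets borel\<close> \<open>B \<in> sets borel\<close>]
    proof (rule nn_integral_cong)
      fix x
      have "emeasure (L x) R = emeasure (K x) (Pair x -` R \<inter> UNIV)"
        unfolding L_def R by (subst emeasure_distr) (auto simp: sets_eq_imp_space_eq[OF sets_K] cong: measurable_cong_sets)
      also have "Pair x -` R \<inter> UNIV = (if x \<in> A then B else {})"
        by (auto simp: R)
      finally show "emeasure (K x) B * indicator A x = emeasure (L x) R"
        by simp
    qed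
    also have "\<dots> = emeasure (distr M borel X \<bind> L) R"
      unfolding R by (rule emeasure_bind[symmetric, OF _ L']) auto
    finally show "emeasure (distr M (borel \<Otimes>\<^sub>M borel) (\<lambda>\<omega>. (X \<omega>, Y \<omega>))) R =
        emeasure (distr M borel X \<bind> L) R" .
  next
    have "sets (distr M borel X \<bind> L) = sets (borel \<Otimes>\<^sub>M borel)"
      by (rule sets_bind) (auto simp: L_def)
    then show "sets (distr M borel X \<bind> L) =
        sigma_sets UNIV {a \<times> b |a b. a \<in> sets borel \<and> b \<in> sets borel}"
      by (simp add: sets_pair_measure)
  next
    show "emeasure (distr M (borel \<Otimes>\<^sub>M borel) (\<lambda>\<omega>. (X \<omega>, Y \<omega>))) UNIV \<noteq> \<infinity>"
      by (simp add: finite_measure.emeasure_finite prob_space.finite_measure prob_space_distr)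
  qed (auto simp: sets_pair_measure intro!: exI[of _ UNIV])
  then have "(\<integral>\<^sup>+\<omega>. f (X \<omega>, Y \<omega>) \<partial>M) = (\<integral>\<^sup>+p. f p \<partial>(distr M borel X \<bind> L))"
    by (subst nn_integral_distr[symmetric, where M'="borel \<Otimes>\<^sub>M borel" and T="\<lambda>\<omega>. (X \<omega>, Y \<omega>)"]) auto
  also have "\<dots> = (\<integral>\<^sup>+x. \<integral>\<^sup>+p. f p \<partial>L x \<partial>distr M borel X)"
    by (rule nn_integral_bind[OF f L'])
  also have "\<dots> = (\<integral>\<^sup>+x. \<integral>\<^sup>+y. f (x, y) \<partial>K x \<partial>distr M borel X)"
    unfolding L_def
    by (intro nn_integral_cong nn_integral_distr) (simp_all cong: measurable_cong_sets)
  finally show ?thesis .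
qed

section \<open>Outer products and covariance matrices\<close>

lemma outer_nth: "outer x y $ i $ j = x $ i * cnj (y $ j)"
  by (simp add: outer_def)

text \<open>The squared entries |x_i|^2 |x_j|^2 sum to |x|^4. The squared norm thereby serves as
  integrable bound for outer products.\<close>

lemma norm_outer: "norm (outer x x) = (norm x)\<^sup>2"
proof -
  have "(norm (outer x x $ i))\<^sup>2 = (cmod (x $ i))\<^sup>2 * (norm x)\<^sup>2" for i
    by (simp add: norm_vec_power2 outer_nth norm_mult power_mult_distrib sum_distrib_left)
  then have "norm (outer x x) = sqrt ((norm x)\<^sup>2 * (norm x)\<^sup>2)"
    unfolding norm_vec_def[of "outer x x"] L2_set_def
    by (simp add: sum_distrib_right[symmetric] norm_vec_power2)
  then show ?thesis
    by (simp only: real_sqrt_abs2 abs_power2)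
qed

lemma integrable_outer:
  fixes X :: "'a \<Rightarrow> complex^'n"
  assumes [measurable]: "X \<in> borel_measurable M" and sq: "integrable M (\<lambda>\<omega>. (norm (X \<omega>))\<^sup>2)"
  shows "integrable M (\<lambda>\<omega>. outer (X \<omega>) (X \<omega>))"
proof -
  have "continuous_on UNIV (\<lambda>x :: complex^'n. outer x x)"
    unfolding outer_def by (intro continuous_on_vec_lambda continuous_intros)
  from borel_measurable_continuous_on[OF this, of X M] show ?thesis
    by (intro Bochner_Integration.integrable_bound[OF sq]) (simp_all add: norm_outer)
qed

text \<open>The diagonal entries of the covariance are the second moments of the components, and a
  nonnegative function with integral 0 vanishes almost everywhere.\<close>

lemma zero_mean_with_cov_0_imp_AE_0:
  fixes X :: "'a \<Rightarrow> complex^'n"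
  assumes "zero_mean_with_cov M X 0"
  shows "AE \<omega> in M. X \<omega> = 0"
proof -
  have int: "integrable M (\<lambda>\<omega>. outer (X \<omega>) (X \<omega>))" and cov: "(\<integral>\<omega>. outer (X \<omega>) (X \<omega>) \<partial>M) = 0"
    using assms by (auto simp: zero_mean_with_cov_def intro: integrable_outer)
  have zero: "AE \<omega> in M. X \<omega> $ i = 0" for i
  proof -
    have lin: "bounded_linear (\<lambda>A :: complex^'n^'n. Re (A $ i $ i))"
      by (intro bounded_linear_compose[OF bounded_linear_Re] bounded_linear_compose[OF bounded_linear_vec_nth]
          bounded_linear_vec_nth)
    have eq: "Re (outer x x $ i $ i) = (cmod (x $ i))\<^sup>2" for x :: "complex^'n"
      by (simp add: outer_nth complex_mult_cnj cmod_power2)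
    have "integrable M (\<lambda>\<omega>. (cmod (X \<omega> $ i))\<^sup>2)"
      using integrable_bounded_linear[OF lin int] by (simp add: eq)
    moreover have "(\<integral>\<omega>. (cmod (X \<omega> $ i))\<^sup>2 \<partial>M) = 0"
      using integral_bounded_linear[OF lin int] by (simp add: eq cov)
    ultimately have "AE \<omega> in M. (cmod (X \<omega> $ i))\<^sup>2 = 0"
      by (subst (asm) integral_nonneg_eq_0_iff_AE) auto
    then show ?thesis
      by simp
  qed
  have "AE \<omega> in M. \<forall>i\<in>UNIV. X \<omega> $ i = 0"
    by (intro AE_finite_allI zero) simp
  then show ?thesis
    by (simp add: vec_eq_iff)
qed

section \<open>Contributions of channel, distortions, noise and interference\<close>

text \<open>Given h = x, independence and zero means leave |a.x|^2 + kt p |u.x|^2 + kr p (sum of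
  |x_i|^2 |u_i|^2), which is then averaged over the channel. In the application \<open>a\<close> is
  d u - v.\<close>

lemma nn_integral_distortion:
  fixes h er n w :: "'a \<Rightarrow> complex^'n"
  assumes model: "uplink_pilot_model M (lam *\<^sub>R mat 1) S kt kr \<sigma> d h et er n w"
    and lam: "lam \<ge> 0"
  shows "(\<integral>\<^sup>+\<omega>. ennreal ((cmod (cdot a (h \<omega>) + et \<omega> * cdot u (h \<omega>) + cdot u (er \<omega>)))\<^sup>2) \<partial>M) =
    ennreal (lam * (norm a)\<^sup>2 + pilot_power d * lam * (kt + kr) * (norm u)\<^sup>2)"
proof -
  interpret uplink_pilot_model M "lam *\<^sub>R mat 1" S kt kr \<sigma> d h et er n w
    by fact
  note [measurable] = measurable_rvs
  define p where "p = pilot_power d"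
  have nonneg: "p \<ge> 0" "kt \<ge> 0" "kr \<ge> 0"
    using kt_nonneg kr_nonneg by (auto simp: p_def pilot_power_def)
  obtain Kr where Kr: "\<And>x. is_complex_normal_vec (rx_distortion_cov kr p x) (Kr x)"
    and cond: "is_conditional_law M h (\<lambda>\<omega>. (et \<omega>, er \<omega>)) (\<lambda>x. complex_normal (kt * p) \<Otimes>\<^sub>M Kr x)"
    using distortion_law by (auto simp: p_def)
  have sets_Kr [measurable_cong, simp]: "sets (Kr x) = sets borel" and prob_Kr: "prob_space (Kr x)" for x
    using is_complex_normal_vecD[OF Kr] by auto
  let ?\<mu> = "distr M borel h"
  have channel: "(\<integral>\<^sup>+x. ennreal ((cmod (cdot v x))\<^sup>2) \<partial>?\<mu>) = ennreal (lam * (norm v)\<^sup>2)" for v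
    using nn_integral_complex_normal_vec_scalar[OF channel_law, of 0 v] by simp
  define F where "F = (\<lambda>(x, e, r). ennreal ((cmod (cdot a x + e * cdot u x + cdot u r))\<^sup>2))"
  have F [measurable]: "F \<in> borel_measurable (borel \<Otimes>\<^sub>M (borel \<Otimes>\<^sub>M borel))"
    unfolding F_def by measurable
  \<comment> \<open>Writing \<open>x $ i\<close> as \<open>cdot (axis i 1) x\<close> lets the single
    fact \<open>channel\<close> average every summand.\<close>
  have inner_F: "(\<integral>\<^sup>+y. F (x, y) \<partial>(complex_normal (kt * p) \<Otimes>\<^sub>M Kr x)) =
      ennreal ((cmod (cdot a x))\<^sup>2) + ennreal (kt * p) * ennreal ((cmod (cdot u x))\<^sup>2) +
      (\<Sum>i\<in>UNIV. ennreal (kr * p * (cmod (u $ i))\<^sup>2) * ennreal ((cmod (cdot (axis i 1) x))\<^sup>2))" for x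
  proof -
    interpret Kr: prob_space "Kr x"
      by (rule prob_Kr)
    interpret CN: prob_space "complex_normal (kt * p)"
      by (rule prob_space_complex_normal)
    let ?s = "\<Sum>i\<in>UNIV. kr * p * (cmod (x $ i))\<^sup>2 * (cmod (u $ i))\<^sup>2"
    have s_nonneg: "?s \<ge> 0"
      using nonneg by (intro sum_nonneg) simp
    have "(\<lambda>y. F (x, y)) \<in> borel_measurable (borel \<Otimes>\<^sub>M borel)"
      by measurable
    then have "(\<integral>\<^sup>+y. F (x, y) \<partial>(complex_normal (kt * p) \<Otimes>\<^sub>M Kr x)) =
        (\<integral>\<^sup>+e. \<integral>\<^sup>+r. F (x, e, r) \<partial>Kr x \<partial>complex_normal (kt * p))"
      by (intro Kr.nn_integral_fst[symmetric]) (simp cong: measurable_cong_sets)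
    \<comment> \<open>The receiver distortion is integrated first, with the other two terms as
      shift; its contribution \<open>?s\<close> does not depend on \<open>e\<close>.\<close>
    also have "\<dots> = (\<integral>\<^sup>+e. ennreal ((cmod (cdot a x + e * cdot u x))\<^sup>2) + ennreal ?s \<partial>complex_normal (kt * p))"
      unfolding F_def split
      by (intro nn_integral_cong, subst nn_integral_complex_normal_vec_diagonal[OF Kr rx_distortion_cov_def])
         (simp add: s_nonneg ennreal_plus)
    also have "\<dots> = ennreal ((cmod (cdot a x))\<^sup>2 + kt * p * (cmod (cdot u x))\<^sup>2) + ennreal ?s"
      using nonneg CN.emeasure_space_1
      by (subst nn_integral_add) (simp_all add: nn_integral_complex_normal cong: measurable_cong_sets)
    also have "ennreal ?s =
        (\<Sum>i\<in>UNIV. ennreal (kr * p * (cmod (u $ i))\<^sup>2) * ennreal ((cmod (cdot (axis i 1) x))\<^sup>2))"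
      using nonneg
      by (subst sum_ennreal[symmetric]) (auto intro!: sum.cong simp: cdot_axis mult_ac ennreal_mult[symmetric])
    finally show ?thesis
      using nonneg by (simp add: ennreal_plus ennreal_mult)
  qed
  have "(\<integral>\<^sup>+\<omega>. ennreal ((cmod (cdot a (h \<omega>) + et \<omega> * cdot u (h \<omega>) + cdot u (er \<omega>)))\<^sup>2) \<partial>M) =
      (\<integral>\<^sup>+\<omega>. F (h \<omega>, et \<omega>, er \<omega>) \<partial>M)"
    by (simp add: F_def)
  also have "\<dots> = (\<integral>\<^sup>+x. \<integral>\<^sup>+y. F (x, y) \<partial>(complex_normal (kt * p) \<Otimes>\<^sub>M Kr x) \<partial>?\<mu>)"
    by (rule nn_integral_conditional_law[OF prob_space_axioms _ _ cond])
       (use F in \<open>simp_all add: borel_prod\<close>)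
  also have "\<dots> = ennreal (lam * (norm a)\<^sup>2) + ennreal (kt * p) * ennreal (lam * (norm u)\<^sup>2) +
      (\<Sum>i\<in>UNIV. ennreal (kr * p * (cmod (u $ i))\<^sup>2) * ennreal (lam * (norm (axis i (1::complex) :: complex^'n))\<^sup>2))"
    unfolding inner_F
    by (simp add: nn_integral_add nn_integral_sum nn_integral_cmult channel)
  also have "\<dots> = ennreal (lam * (norm a)\<^sup>2 + kt * p * (lam * (norm u)\<^sup>2) +
      (\<Sum>i\<in>UNIV. kr * p * (cmod (u $ i))\<^sup>2 * lam))"
    using nonneg lam
    by (simp add: norm_axis_power2 ennreal_plus[symmetric] ennreal_mult[symmetric] sum_nonneg del: ennreal_plus)
  also have "(\<Sum>i\<in>UNIV. kr * p * (cmod (u $ i))\<^sup>2 * lam) = kr * p * lam * (norm u)\<^sup>2"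
    by (simp add: norm_vec_power2 sum_distrib_left mult_ac)
  finally show ?thesis
    by (simp add: p_def algebra_simps)
qed

text \<open>Independence of the generated sigma-algebras gives agreement on rectangles, which
  determines the product measure. This permits integrating over the noise separately.\<close>

lemma (in prob_space) indep_set_vimage_imp_distr_pair:
  assumes X [measurable]: "X \<in> M \<rightarrow>\<^sub>M S" and Y [measurable]: "Y \<in> M \<rightarrow>\<^sub>M T"
    and indep: "indep_set (sets (vimage_algebra (space M) X S)) (sets (vimage_algebra (space M) Y T))"
  shows "distr M S X \<Otimes>\<^sub>M distr M T Y = distr M (S \<Otimes>\<^sub>M T) (\<lambda>\<omega>. (X \<omega>, Y \<omega>))"
proof -
  interpret X: prob_space "distr M S X"
    by (rule prob_space_distr) fact
  interpret Y: prob_space "distr M T Y"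
    by (rule prob_space_distr) fact
  show ?thesis
  proof (rule pair_measure_eqI)
    fix A B
    assume "A \<in> sets (distr M S X)" "B \<in> sets (distr M T Y)"
    then have AB [measurable]: "A \<in> sets S" "B \<in> sets T"
      by auto
    have "prob ((X -` A \<inter> space M) \<inter> (Y -` B \<inter> space M)) = prob (X -` A \<inter> space M) * prob (Y -` B \<inter> space M)"
      by (rule indep_setD[OF indep]) (auto intro: in_vimage_algebra AB)
    moreover have "(\<lambda>\<omega>. (X \<omega>, Y \<omega>)) -` (A \<times> B) \<inter> space M = (X -` A \<inter> space M) \<inter> (Y -` B \<inter> space M)"
      by auto
    ultimately show "emeasure (distr M S X) A * emeasure (distr M T Y) B =
        emeasure (distr M (S \<Otimes>\<^sub>M T) (\<lambda>\<omega>. (X \<omega>, Y \<omega>))) (A \<times> B)"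
      by (simp add: emeasure_distr AB emeasure_eq_measure ennreal_mult[symmetric])
  qed (auto intro: X.sigma_finite_measure_axioms Y.sigma_finite_measure_axioms)
qed

lemma nn_integral_observation:
  fixes h er n w :: "'a \<Rightarrow> complex^'n"
  assumes model: "uplink_pilot_model M (lam *\<^sub>R mat 1) 0 kt kr \<sigma> d h et er n w"
    and lam: "lam \<ge> 0"
    and z: "z = pilot_observation d h et er (\<lambda>\<omega>. n \<omega> + w \<omega>)"
  shows "(\<integral>\<^sup>+\<omega>. ennreal ((cmod (cdot u (z \<omega>) - cdot v (h \<omega>)))\<^sup>2) \<partial>M) =
    ennreal (lam * (norm (d *s u - v))\<^sup>2 + (pilot_power d * lam * (kt + kr) + \<sigma>\<^sup>2) * (norm u)\<^sup>2)"
proof -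
  interpret uplink_pilot_model M "lam *\<^sub>R mat 1" 0 kt kr \<sigma> d h et er n w
    by fact
  note [measurable] = measurable_rvs
  have nonneg: "pilot_power d \<ge> 0" "kt \<ge> 0" "kr \<ge> 0"
    using kt_nonneg kr_nonneg by (auto simp: pilot_power_def)
  let ?Y = "\<lambda>\<omega>. (h \<omega>, et \<omega>, er \<omega>, w \<omega>)"
  let ?N = "borel \<Otimes>\<^sub>M (borel \<Otimes>\<^sub>M (borel \<Otimes>\<^sub>M borel))"
  \<comment> \<open>The estimation error without the receiver noise, as a function of channel,
    distortions and interference.\<close>
  define D where "D = (\<lambda>(x, e, r, w'). cdot (d *s u - v) x + e * cdot u x + cdot u r + cdot u w')"
  have D [measurable]: "D \<in> borel_measurable ?N"
    unfolding D_def by measurable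
  have Y [measurable]: "?Y \<in> M \<rightarrow>\<^sub>M ?N"
    by measurable
  have joint: "distr M borel n \<Otimes>\<^sub>M distr M ?N ?Y = distr M (borel \<Otimes>\<^sub>M ?N) (\<lambda>\<omega>. (n \<omega>, ?Y \<omega>))"
    using noise_indep by (intro indep_set_vimage_imp_distr_pair) (simp_all add: borel_prod)
  interpret noise: prob_space "distr M borel n"
    by (rule prob_space_distr) measurable
  interpret rest: prob_space "distr M ?N ?Y"
    by (rule prob_space_distr) measurable
  interpret np: pair_prob_space "distr M borel n" "distr M ?N ?Y" ..
  have "cdot u (z \<omega>) - cdot v (h \<omega>) = D (?Y \<omega>) + cdot u (n \<omega>)" for \<omega>
    by (simp add: z pilot_observation_def D_def cdot_simps algebra_simps)
  then have "(\<integral>\<^sup>+\<omega>. ennreal ((cmod (cdot u (z \<omega>) - cdot v (h \<omega>)))\<^sup>2) \<partial>M) =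
      (\<integral>\<^sup>+\<omega>. (case (n \<omega>, ?Y \<omega>) of (x, y) \<Rightarrow> ennreal ((cmod (D y + cdot u x))\<^sup>2)) \<partial>M)"
    by simp
  also have "\<dots> = (\<integral>\<^sup>+(x, y). ennreal ((cmod (D y + cdot u x))\<^sup>2) \<partial>(distr M borel n \<Otimes>\<^sub>M distr M ?N ?Y))"
    unfolding joint by (rule nn_integral_distr[symmetric]) measurable
  \<comment> \<open>With the noise as inner variable, \<open>D y\<close> is a constant shift and the
    second moment of a scalar complex normal law applies.\<close>
  also have "\<dots> = (\<integral>\<^sup>+y. \<integral>\<^sup>+x. ennreal ((cmod (D y + cdot u x))\<^sup>2) \<partial>distr M borel n \<partial>distr M ?N ?Y)"
    by (subst np.nn_integral_snd[symmetric]) (simp_all cong: measurable_cong_sets)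
  also have "\<dots> = (\<integral>\<^sup>+y. ennreal ((cmod (D y))\<^sup>2) + ennreal (\<sigma>\<^sup>2 * (norm u)\<^sup>2) \<partial>distr M ?N ?Y)"
    by (simp add: nn_integral_complex_normal_vec_scalar[OF noise_law] ennreal_plus)
  also have "\<dots> = (\<integral>\<^sup>+\<omega>. ennreal ((cmod (D (?Y \<omega>)))\<^sup>2) \<partial>M) + ennreal (\<sigma>\<^sup>2 * (norm u)\<^sup>2)"
    using rest.emeasure_space_1
    by (subst nn_integral_add) (simp_all add: nn_integral_distr)
  \<comment> \<open>The interference has covariance 0, so it vanishes almost surely, whatever its
    correlation with the rest.\<close>
  also have "(\<integral>\<^sup>+\<omega>. ennreal ((cmod (D (?Y \<omega>)))\<^sup>2) \<partial>M) =
      (\<integral>\<^sup>+\<omega>. ennreal ((cmod (cdot (d *s u - v) (h \<omega>) + et \<omega> * cdot u (h \<omega>) + cdot u (er \<omega>)))\<^sup>2) \<partial>M)"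
    using zero_mean_with_cov_0_imp_AE_0[OF interference]
    by (intro nn_integral_cong_AE) (auto simp: D_def cdot_simps)
  also have "\<dots> = ennreal (lam * (norm (d *s u - v))\<^sup>2 + pilot_power d * lam * (kt + kr) * (norm u)\<^sup>2)"
    by (rule nn_integral_distortion[OF model lam])
  finally show ?thesis
    using lam nonneg by (simp add: ennreal_plus[symmetric] algebra_simps del: ennreal_plus)
qed

section \<open>The LMMSE estimator\<close>

text \<open>These are the norms of the test vectors for polarization: the two multiples add up on
  the same axis and are orthogonal otherwise.\<close>

lemma norm_axis_add_axis_power2:
  "(norm (axis i (1::complex) + axis j s :: complex^'n))\<^sup>2 =
    (if i = j then (cmod (1 + s))\<^sup>2 else 1 + (cmod s)\<^sup>2)"
proof (cases "i = j")
  case True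
  then have "axis i (1::complex) + axis j s = (axis i (1 + s) :: complex^'n)"
    by (simp add: vec_eq_iff axis_def)
  then show ?thesis
    using True by (simp add: norm_axis_power2)
next
  case False
  then have "orthogonal (axis i (1::complex) :: complex^'n) (axis j s)"
    by (simp add: orthogonal_def inner_axis_axis)
  from norm_add_Pythagorean[OF this] show ?thesis
    using False by (simp add: norm_axis_power2)
qed

lemma complex_polarization:
  "x * cnj y = (1 / 4) * of_real ((cmod (x + y))\<^sup>2 - (cmod (x - y))\<^sup>2) +
     (\<i> / 4) * of_real ((cmod (x + \<i> * y))\<^sup>2 - (cmod (x - \<i> * y))\<^sup>2)"
  unfolding complex_eq_iff cmod_power2 by (simp add: power2_eq_square algebra_simps)

text \<open>Polarization with the test vectors e_i + s e_j, s = 1, -1, \<i>, -\<i>, yields entry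
  (i,j). For distinct indices all four norms coincide and the differences cancel.\<close>

lemma integral_outer_eq_scalar:
  fixes X :: "'a \<Rightarrow> complex^'n"
  assumes X [measurable]: "X \<in> borel_measurable M"
    and moment: "\<And>u. has_bochner_integral M (\<lambda>\<omega>. (cmod (cdot u (X \<omega>)))\<^sup>2) (k * (norm u)\<^sup>2)"
  shows "(\<integral>\<omega>. outer (X \<omega>) (X \<omega>) \<partial>M) = k *\<^sub>R mat 1"
proof -
  have "integrable M (\<lambda>\<omega>. \<Sum>i\<in>UNIV. (cmod (cdot (axis i 1) (X \<omega>)))\<^sup>2)"
    using moment by (auto simp: has_bochner_integral_iff)
  then have int: "integrable M (\<lambda>\<omega>. outer (X \<omega>) (X \<omega>))"
    by (intro integrable_outer) (simp_all add: cdot_axis norm_vec_power2)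
  have "(\<integral>\<omega>. outer (X \<omega>) (X \<omega>) \<partial>M) $ i $ j = (if i = j then of_real k else 0)" for i j
  proof -
    have lin: "bounded_linear (\<lambda>A :: complex^'n^'n. A $ i $ j)"
      by (intro bounded_linear_compose[OF bounded_linear_vec_nth] bounded_linear_vec_nth)
    have mom: "has_bochner_integral M (\<lambda>\<omega>. (cmod (X \<omega> $ i + s * X \<omega> $ j))\<^sup>2)
        (k * (norm (axis i (1::complex) + axis j s :: complex^'n))\<^sup>2)" for s
      using moment[of "axis i 1 + axis j s"] by (simp add: cdot_simps cdot_axis)
    have "has_bochner_integral M (\<lambda>\<omega>. X \<omega> $ i * cnj (X \<omega> $ j)) (if i = j then of_real k else 0)"
    proof -
      have "has_bochner_integral M (\<lambda>\<omega>. X \<omega> $ i * cnj (X \<omega> $ j))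
        ((1 / 4) * of_real (k * (norm (axis i (1::complex) + axis j 1 :: complex^'n))\<^sup>2 -
             k * (norm (axis i (1::complex) + axis j (- 1) :: complex^'n))\<^sup>2) +
         (\<i> / 4) * of_real (k * (norm (axis i (1::complex) + axis j \<i> :: complex^'n))\<^sup>2 -
             k * (norm (axis i (1::complex) + axis j (- \<i>) :: complex^'n))\<^sup>2))"
        unfolding complex_polarization
        using mom[of 1] mom[of "- 1"] mom[of \<i>] mom[of "- \<i>"]
        by (intro has_bochner_integral_add has_bochner_integral_mult_right has_bochner_integral_of_real
            has_bochner_integral_diff) simp_all
      then show ?thesis
        by (auto simp: norm_axis_add_axis_power2 cmod_power2 split: if_splits)
    qed
    then show ?thesis
      using integral_bounded_linear[OF lin int] by (simp add: outer_nth has_bochner_integral_iff)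
  qed
  then show ?thesis
    by (simp add: vec_eq_iff mat_def of_real_def)
qed

section \<open>Completing the square and minimizing the mean square error\<close>

lemma Re_of_real_mult: "Re (of_real r * z) = r * Re z"
  by simp

text \<open>Matching the cross term forces the centre lam cnj(d) / c; subtracting c times its
  squared modulus from lam leaves the coefficient of |t|^2.\<close>

lemma complete_square_complex:
  fixes d x t :: complex and lam e :: real
  assumes "lam * (cmod d)\<^sup>2 + e \<noteq> 0"
  defines "c \<equiv> lam * (cmod d)\<^sup>2 + e"
  shows "lam * (cmod (d * x - t))\<^sup>2 + e * (cmod x)\<^sup>2 =
    c * (cmod (x - of_real lam * cnj d / of_real c * t))\<^sup>2 + (lam - lam\<^sup>2 * (cmod d)\<^sup>2 / c) * (cmod t)\<^sup>2"
proof -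
  have sq: "(cmod (a - b))\<^sup>2 = (cmod a)\<^sup>2 + (cmod b)\<^sup>2 - 2 * Re (a * cnj b)" for a b
    unfolding cmod_power2 by (simp add: power2_eq_square algebra_simps)
  let ?\<alpha> = "of_real lam * cnj d / of_real c"
  have c: "c \<noteq> 0"
    using assms by simp
  have "of_real c * (x * cnj (?\<alpha> * t)) = of_real lam * (d * x * cnj t)"
    using c by simp
  from arg_cong[OF this, of Re] have cross: "c * Re (x * cnj (?\<alpha> * t)) = lam * Re (d * x * cnj t)"
    by (simp only: Re_of_real_mult)
  have "cmod ?\<alpha> = \<bar>lam\<bar> * cmod d / \<bar>c\<bar>"
    by (simp add: norm_mult norm_divide)
  then have "c * (cmod ?\<alpha>)\<^sup>2 = lam\<^sup>2 * (cmod d)\<^sup>2 / c"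
    using c by (simp add: power_mult_distrib power_divide) (simp add: power2_eq_square)
  then have square: "c * (cmod (?\<alpha> * t))\<^sup>2 = lam\<^sup>2 * (cmod d)\<^sup>2 / c * (cmod t)\<^sup>2"
    unfolding norm_mult[of ?\<alpha>] power_mult_distrib by (simp only: mult.assoc[symmetric])
  have "c * (cmod (x - ?\<alpha> * t))\<^sup>2 + (lam - lam\<^sup>2 * (cmod d)\<^sup>2 / c) * (cmod t)\<^sup>2 =
      c * (cmod x)\<^sup>2 + c * (cmod (?\<alpha> * t))\<^sup>2 - 2 * (c * Re (x * cnj (?\<alpha> * t))) +
      (lam - lam\<^sup>2 * (cmod d)\<^sup>2 / c) * (cmod t)\<^sup>2"
    unfolding sq by (simp add: algebra_simps)
  also have "\<dots> = c * (cmod x)\<^sup>2 + lam * (cmod t)\<^sup>2 - 2 * (lam * Re (d * x * cnj t))"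
    unfolding cross square by (simp add: algebra_simps)
  also have "\<dots> = lam * (cmod (d * x - t))\<^sup>2 + e * (cmod x)\<^sup>2"
    unfolding sq by (simp add: norm_mult power_mult_distrib c_def algebra_simps)
  finally show ?thesis ..
qed

lemma lmmse_scalar_covariance:
  fixes h er n w :: "'a \<Rightarrow> complex^'n"
  assumes model: "uplink_pilot_model M (lam *\<^sub>R mat 1) 0 kt kr \<sigma> d h et er n w"
    and lam: "lam > 0"
    and z: "z = pilot_observation d h et er (\<lambda>\<omega>. n \<omega> + w \<omega>)"
  shows "\<exists>!A. is_lmmse_matrix M h z A"
    "error_cov M h (lmmse_estimator M h z) =
      (lam * (1 - pilot_power d * lam / (pilot_power d * lam * (1 + kt + kr) + \<sigma>\<^sup>2))) *\<^sub>R mat 1"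
proof -
  interpret uplink_pilot_model M "lam *\<^sub>R mat 1" 0 kt kr \<sigma> d h et er n w
    by fact
  note [measurable] = measurable_rvs
  have "(\<lambda>\<omega>. (d + et \<omega>) *s h \<omega>) \<in> borel_measurable M"
  proof -
    have "continuous_on UNIV (\<lambda>p :: complex \<times> (complex^'n). fst p *s snd p)"
      unfolding vector_scalar_mult_def by (intro continuous_on_vec_lambda continuous_intros)
    from borel_measurable_continuous_on[OF this, of "\<lambda>\<omega>. (d + et \<omega>, h \<omega>)" M] show ?thesis
      by simp
  qed
  then have [measurable]: "z \<in> borel_measurable M"
    unfolding z pilot_observation_def by measurable
  define p where "p = pilot_power d"
  \<comment> \<open>The weight of |u|^2 due to distortions and noise. Then E{z z^H} = c I, and
    \<open>\<alpha>\<close> is the scalar in lam cnj(d) (c I)^{-1}.\<close>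
  define e where "e = p * lam * (kt + kr) + \<sigma>\<^sup>2"
  define c where "c = lam * (cmod d)\<^sup>2 + e"
  define \<alpha> where "\<alpha> = of_real lam * cnj d / of_real c"
  define k where "k = lam - lam\<^sup>2 * (cmod d)\<^sup>2 / c"
  have p: "p = (cmod d)\<^sup>2"
    by (simp add: p_def pilot_power_def)
  have "e > 0"
    using kt_nonneg kr_nonneg sigma_pos lam unfolding e_def p by (intro add_nonneg_pos) auto
  then have c_pos: "c > 0"
    using lam unfolding c_def by (intro add_nonneg_pos) auto
  have square: "lam * (norm (d *s u - v))\<^sup>2 + e * (norm u)\<^sup>2 = c * (norm (u - \<alpha> *s v))\<^sup>2 + k * (norm v)\<^sup>2"
    for u v :: "complex^'n"
  proof -
    have scalar: "lam * (cmod (d * x - t))\<^sup>2 + e * (cmod x)\<^sup>2 =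
        c * (cmod (x - \<alpha> * t))\<^sup>2 + k * (cmod t)\<^sup>2" for x t
      using complete_square_complex[of lam d e x t] c_pos
      unfolding c_def[symmetric] \<alpha>_def[symmetric] k_def[symmetric] by simp
    have "lam * (norm (d *s u - v))\<^sup>2 + e * (norm u)\<^sup>2 =
        (\<Sum>i\<in>UNIV. lam * (cmod (d * u $ i - v $ i))\<^sup>2 + e * (cmod (u $ i))\<^sup>2)"
      by (simp add: norm_vec_power2 sum_distrib_left sum.distrib)
    also have "\<dots> = c * (norm (u - \<alpha> *s v))\<^sup>2 + k * (norm v)\<^sup>2"
      unfolding scalar by (simp add: norm_vec_power2 sum_distrib_left sum.distrib)
    finally show ?thesis .
  qed
  have moment: "has_bochner_integral M (\<lambda>\<omega>. (cmod (cdot u (z \<omega>) - cdot v (h \<omega>)))\<^sup>2)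
      (c * (norm (u - \<alpha> *s v))\<^sup>2 + k * (norm v)\<^sup>2)" for u v
  proof -
    \<comment> \<open>Nonnegativity is needed because \<open>ennreal\<close> sends negative numbers
      to 0; with it, the finite integral yields integrability and the real expectation
      together.\<close>
    have "lam * (norm (d *s u - v))\<^sup>2 + e * (norm u)\<^sup>2 \<ge> 0"
      using lam \<open>e > 0\<close> by simp
    with nn_integral_observation[OF model less_imp_le[OF lam] z, of u v] show ?thesis
      unfolding has_bochner_integral_iff p_def[symmetric] e_def[symmetric] square
      by (subst (asm) nn_integral_eq_integrable) simp_all
  qed
  \<comment> \<open>The candidate \<alpha> I, given by its rows. Row i of an estimator only affects
    the error of component i, with v = e_i, so the mean square error splits over the rows.\<close>
  define A0 :: "complex^'n^'n" where "A0 = (\<chi> i. \<alpha> *s axis i 1)"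
  have mse: "mse M h z A = c * (\<Sum>i\<in>UNIV. (norm (A $ i - A0 $ i))\<^sup>2) + k * CARD('n)" for A
  proof -
    have "(norm (A *v x - y))\<^sup>2 = (\<Sum>i\<in>UNIV. (cmod (cdot (A $ i) x - cdot (axis i 1) y))\<^sup>2)" for x y
      by (simp add: norm_vec_power2 cdot_axis) (simp add: cdot_def matrix_vector_mult_def)
    then have "mse M h z A = (\<Sum>i\<in>UNIV. c * (norm (A $ i - \<alpha> *s axis i 1))\<^sup>2 + k * (norm (axis i (1::complex) :: complex^'n))\<^sup>2)"
      unfolding mse_def using moment
      by (simp add: has_bochner_integral_iff)
    then show ?thesis
      by (simp add: A0_def norm_axis_power2 sum.distrib sum_distrib_left mult.commute)
  qed
  have mse_A0: "mse M h z A0 = k * CARD('n)"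
    by (simp add: mse)
  have lmmse: "is_lmmse_matrix M h z A \<longleftrightarrow> A = A0" for A
  proof
    assume "is_lmmse_matrix M h z A"
    then have "mse M h z A \<le> mse M h z A0"
      by (simp add: is_lmmse_matrix_def)
    then have "(\<Sum>i\<in>UNIV. (norm (A $ i - A0 $ i))\<^sup>2) \<le> 0"
      using c_pos unfolding mse_A0 mse[of A] by (simp add: mult_le_0_iff)
    then have "(\<Sum>i\<in>UNIV. (norm (A $ i - A0 $ i))\<^sup>2) = 0"
      by (intro antisym sum_nonneg) auto
    then show "A = A0"
      by (simp add: sum_nonneg_eq_0_iff vec_eq_iff)
  next
    assume "A = A0"
    then show "is_lmmse_matrix M h z A"
      using c_pos by (simp add: is_lmmse_matrix_def mse sum_nonneg)
  qed
  then show "\<exists>!A. is_lmmse_matrix M h z A"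
    by simp
  have A0_mult: "A0 *v x = \<alpha> *s x" for x
    by (simp add: vec_eq_iff A0_def matrix_vector_mult_def axis_def if_distrib if_distribR cong: if_cong)
  have est: "lmmse_estimator M h z = (\<lambda>\<omega>. A0 *v z \<omega>)"
    by (simp add: lmmse_estimator_def lmmse)
  have "error_cov M h (lmmse_estimator M h z) = k *\<^sub>R mat 1"
    unfolding error_cov_def est
  proof (rule integral_outer_eq_scalar)
    show "(\<lambda>\<omega>. A0 *v z \<omega> - h \<omega>) \<in> borel_measurable M"
      by (intro borel_measurable_diff borel_measurable_continuous_on[OF matrix_vector_mult_linear_continuous_on]) measurable
    show "has_bochner_integral M (\<lambda>\<omega>. (cmod (cdot u (A0 *v z \<omega> - h \<omega>)))\<^sup>2) (k * (norm u)\<^sup>2)" for u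
      using moment[of "\<alpha> *s u" u] by (simp add: A0_mult cdot_simps)
  qed
  moreover have k: "k = lam * (1 - (cmod d)\<^sup>2 * lam / c)"
    by (simp add: k_def power2_eq_square right_diff_distrib)
  have "c = pilot_power d * lam * (1 + kt + kr) + \<sigma>\<^sup>2"
    by (simp add: c_def e_def p_def pilot_power_def algebra_simps)
  then have "k = lam * (1 - pilot_power d * lam / (pilot_power d * lam * (1 + kt + kr) + \<sigma>\<^sup>2))"
    unfolding k by (simp only: pilot_power_def)
  ultimately show "error_cov M h (lmmse_estimator M h z) =
      (lam * (1 - pilot_power d * lam / (pilot_power d * lam * (1 + kt + kr) + \<sigma>\<^sup>2))) *\<^sub>R mat 1"
    by simp
qed

section \<open>The high power limit\<close>

text \<open>Dividing numerator and denominator by p > 0 leaves \<open>s / p\<close> as the only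
  dependence on p, and it tends to 0.\<close>

lemma error_cov_coefficient_tendsto:
  fixes lam kt kr s :: real
  assumes "lam > 0" "kt \<ge> 0" "kr \<ge> 0"
  shows "((\<lambda>p. lam * (1 - p * lam / (p * lam * (1 + kt + kr) + s))) \<longlongrightarrow> lam * (1 - 1 / (1 + kt + kr))) at_top"
proof -
  have "((\<lambda>p. lam * (1 - lam / (lam * (1 + kt + kr) + s / p))) \<longlongrightarrow> lam * (1 - lam / (lam * (1 + kt + kr) + 0))) at_top"
    using assms by (intro tendsto_intros tendsto_divide_0[OF tendsto_const] filterlim_at_top_imp_at_infinity filterlim_ident) auto
  also have "lam * (1 - lam / (lam * (1 + kt + kr) + 0)) = lam * (1 - 1 / (1 + kt + kr))"
    using assms by simp
  finally show ?thesis
  proof (rule Lim_transform_eventually)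
    show "\<forall>\<^sub>F p in at_top. lam * (1 - lam / (lam * (1 + kt + kr) + s / p)) =
        lam * (1 - p * lam / (p * lam * (1 + kt + kr) + s))"
      using eventually_gt_at_top[of 0]
    proof eventually_elim
      case (elim p)
      then have "p * lam * (1 + kt + kr) + s = p * (lam * (1 + kt + kr) + s / p)"
        by (simp add: distrib_left)
      moreover have "p * lam / (p * (lam * (1 + kt + kr) + s / p)) = lam / (lam * (1 + kt + kr) + s / p)"
        using elim by (intro mult_divide_mult_cancel_left) simp
      ultimately show ?case
        by (simp only:)
    qed
  qed
qed

text \<open>Every pilot has its own probability space and random variables, since the distortion
  laws depend on d. The filter \<open>filtercomap pilot_power at_top\<close> lets |d|^2 tend to
  infinity with the phase of d unrestricted. The closed form assumes the model at the pilot
  considered, the limit at all pilots.\<close>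

theorem corollary1:
  fixes M :: "complex \<Rightarrow> 'a measure"
    and h er n w z :: "complex \<Rightarrow> 'a \<Rightarrow> complex^'n"
    and et :: "complex \<Rightarrow> 'a \<Rightarrow> complex"
    and kt kr \<sigma> lam :: real
  assumes "lam > 0"
    and "\<And>d. z d = pilot_observation d (h d) (et d) (er d) (\<lambda>\<omega>. n d \<omega> + w d \<omega>)"
  shows "(\<forall>d. uplink_pilot_model (M d) (lam *\<^sub>R mat 1) 0 kt kr \<sigma> d (h d) (et d) (er d) (n d) (w d)
           \<longrightarrow> (\<exists>!A. is_lmmse_matrix (M d) (h d) (z d) A) \<and>
               error_cov (M d) (h d) (lmmse_estimator (M d) (h d) (z d)) =
                 (lam * (1 - pilot_power d * lam /
                    (pilot_power d * lam * (1 + kt + kr) + \<sigma>\<^sup>2))) *\<^sub>R mat 1)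
       \<and> ((\<forall>d. uplink_pilot_model (M d) (lam *\<^sub>R mat 1) 0 kt kr \<sigma> d (h d) (et d) (er d) (n d) (w d))
           \<longrightarrow> ((\<lambda>d. error_cov (M d) (h d) (lmmse_estimator (M d) (h d) (z d)))
                 \<longlongrightarrow> (lam * (1 - 1 / (1 + kt + kr))) *\<^sub>R mat 1)
                (filtercomap pilot_power at_top))"
proof (intro conjI impI allI)
  fix d
  assume model: "uplink_pilot_model (M d) (lam *\<^sub>R mat 1) 0 kt kr \<sigma> d (h d) (et d) (er d) (n d) (w d)"
  note lmmse = lmmse_scalar_covariance[OF model assms(1) assms(2)]
  show "\<exists>!A. is_lmmse_matrix (M d) (h d) (z d) A"
    by (rule lmmse(1))
  show "error_cov (M d) (h d) (lmmse_estimator (M d) (h d) (z d)) =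
      (lam * (1 - pilot_power d * lam / (pilot_power d * lam * (1 + kt + kr) + \<sigma>\<^sup>2))) *\<^sub>R mat 1"
    by (rule lmmse(2))
next
  assume model: "\<forall>d. uplink_pilot_model (M d) (lam *\<^sub>R mat 1) 0 kt kr \<sigma> d (h d) (et d) (er d) (n d) (w d)"
  note nonneg = uplink_pilot_model.kt_nonneg[OF model[rule_format]]
    uplink_pilot_model.kr_nonneg[OF model[rule_format]]
  note lim = error_cov_coefficient_tendsto[OF assms(1) nonneg, of "\<sigma>\<^sup>2"]
  have "((\<lambda>d. (lam * (1 - pilot_power d * lam / (pilot_power d * lam * (1 + kt + kr) + \<sigma>\<^sup>2))) *\<^sub>R mat 1)
      \<longlongrightarrow> (lam * (1 - 1 / (1 + kt + kr))) *\<^sub>R (mat 1 :: complex^'n^'n)) (filtercomap pilot_power at_top)"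
    \<comment> \<open>Along this filter \<open>pilot_power\<close> tends to infinity by
      construction, so the real limit composes with it.\<close>
    by (intro tendsto_scaleR tendsto_const filterlim_compose[OF lim filterlim_filtercomap])
  then show "((\<lambda>d. error_cov (M d) (h d) (lmmse_estimator (M d) (h d) (z d)))
      \<longlongrightarrow> (lam * (1 - 1 / (1 + kt + kr))) *\<^sub>R mat 1) (filtercomap pilot_power at_top)"
    using lmmse_scalar_covariance(2)[OF model[rule_format] assms(1) assms(2)] by simp
qed

end
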